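(* Let $t \ge 1$ be an integer. For any integer $s$ with $0 < s < 2^t$, there exists no $t$-$(v,t+1)$ Latin trade of volume $s$ (for any positive integer $v$).
   Context: Let $t \le k$ and $v$ be positive integers, $V = \{1,\dots,v\}$, and let $V^k$ be the set of ordered $k$-tuples of elements of $V$. For a $t$-subset $I = \{i_1 < \cdots < i_t\}$ of $\{1,\dots,k\}$ and $(u_1,\dots,u_t) \in V^t$, the tuple $(x_1,\dots,x_k) \in V^k$ is said to contain $(u_1,\dots,u_t)_I$ if $x_{i_j} = u_j$ for all $j = 1,\dots,t$. A $t$-$(v,k)$ Latin trade of volume $s$ is a pair $T = (T_1,T_2)$ of disjoint collections (finite multisets, i.e. repeated elements are allowed; disjoint means no tuple occurs in both), each consisting of $s$ elements of $V^k$ counted with multiplicity, such that for each $t$-subset $I \subseteq \{1,\dots,k\}$ and each $(u_1,\dots,u_t) \in V^t$, the number of elements (with multiplicity) of $T_1$ containing $(u_1,\dots,u_t)_I$ equals the number of elements of $T_2$ containing $(u_1,\dots,u_t)_I$. *)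

theory Defs
  imports Main "HOL-Library.Multiset"
begin

text \<open>
  A tuple \<open>(x\<^sub>1, \<dots>, x\<^sub>k)\<close> is represented by the list of its entries. List positions start
  at 0, so coordinate \<open>i\<close> of the tuple is \<open>x ! (i - 1)\<close>, and coordinate sets
  \<open>I \<subseteq> {1..k}\<close> become position sets \<open>I \<subseteq> {0..<k}\<close>.
\<close>

definition tuples :: "nat \<Rightarrow> nat \<Rightarrow> nat list set" where
  "tuples v k = {x. length x = k \<and> set x \<subseteq> {1..v}}"

text \<open>
  \<open>contains x I u\<close> is meant for \<open>length u = card I\<close>; \<open>sorted_list_of_set I\<close> enumerates
  \<open>I\<close> in increasing order.
\<close>

definition contains :: "nat list \<Rightarrow> nat set \<Rightarrow> nat list \<Rightarrow> bool" where
  "contains x I u \<longleftrightarrow> (\<forall>j<card I. x ! (sorted_list_of_set I ! j) = u ! j)"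

text \<open>
  The standing assumptions \<open>1 \<le> t \<le> k\<close> and \<open>1 \<le> v\<close> are not part of this predicate.
  Since \<open>filter_mset\<close> keeps multiplicities, its \<open>size\<close> counts elements with multiplicity.
\<close>

definition latin_trade ::
  "nat \<Rightarrow> nat \<Rightarrow> nat \<Rightarrow> nat \<Rightarrow> nat list multiset \<times> nat list multiset \<Rightarrow> bool" where
  "latin_trade t v k s T \<longleftrightarrow>
     set_mset (fst T) \<subseteq> tuples v k \<and> set_mset (snd T) \<subseteq> tuples v k \<and>
     size (fst T) = s \<and> size (snd T) = s \<and>
     set_mset (fst T) \<inter> set_mset (snd T) = {} \<and>
     (\<forall>I u. I \<subseteq> {0..<k} \<longrightarrow> card I = t \<longrightarrow> u \<in> tuples v t \<longrightarrow>
        size {#x \<in># fst T. contains x I u#} = size {#x \<in># snd T. contains x I u#})"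

end

theory Submission
  imports Defs
begin

text \<open>
  The difference \<open>f\<close> of the two multiplicity functions of a trade is a nonzero integer function on
  \<open>V\<^sup>t\<^sup>+\<^sup>1\<close> whose sum along every axis-parallel line vanishes. Such a function on \<open>V\<^sup>n\<close> has
  \<open>\<ell>\<^sub>1\<close>-norm at least \<open>2\<^sup>n\<close>: a line in the first direction through a nonzero value contains a second
  nonzero value, so two of the slices obtained by fixing the first coordinate are nonzero, and
  induction applies to both. As the \<open>\<ell>\<^sub>1\<close>-norm of \<open>f\<close> is \<open>2s\<close>, we get \<open>s \<ge> 2\<^sup>t\<close>.
\<close>

lemma sum_abs_ge_power2_if_line_sums_zero:
  fixes f :: "'a list \<Rightarrow> int"
  assumes "finite V"
    and "\<And>xs ys. length xs + length ys + 1 = n \<Longrightarrow> set xs \<subseteq> V \<Longrightarrow> set ys \<subseteq> V \<Longrightarrow>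
           (\<Sum>a\<in>V. f (xs @ a # ys)) = 0"
    and "length x = n" "set x \<subseteq> V" "f x \<noteq> 0"
  shows "2 ^ n \<le> (\<Sum>x | length x = n \<and> set x \<subseteq> V. \<bar>f x\<bar>)"
  using assms(2-)
proof (induction n arbitrary: f x)
  case 0
  then have "{x. length x = 0 \<and> set x \<subseteq> V} = {[]}" and "f [] \<noteq> 0" by auto
  then show ?case by (simp del: length_0_conv)
next
  case (Suc n)
  let ?L = "\<lambda>n. {x. length x = n \<and> set x \<subseteq> V}"
  have fin: "finite (?L m)" for m
    using finite_lists_length_eq[OF assms(1), of m] by (simp add: conj_commute)
  from Suc.prems obtain a y where x: "x = a # y" "length y = n" "a \<in> V" "set y \<subseteq> V"
    by (cases x) auto
  \<comment> \<open>The empty prefix selects the line through \<open>x\<close> in the first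
    direction. Its sum vanishes while \<open>f x\<close> does not, so another point of the line has
    a nonzero value.\<close>
  have "(\<Sum>c\<in>V. f (c # y)) = 0" using Suc.prems(1)[of "[]" y] x by simp
  then have "(\<Sum>c\<in>V - {a}. f (c # y)) \<noteq> 0"
    using sum.remove[OF assms(1) x(3), of "\<lambda>c. f (c # y)"] Suc.prems(4) x(1) by simp
  then obtain b where b: "b \<in> V" "b \<noteq> a" "f (b # y) \<noteq> 0"
    by (auto elim: sum.not_neutral_contains_not_neutral)
  \<comment> \<open>The same tail \<open>y\<close> witnesses that both slices, at \<open>a\<close>
    and at \<open>b\<close>, are nonzero. A line inside the slice at \<open>c\<close> is a line of
    the whole space with prefix \<open>c # xs\<close>.\<close>
  have slice: "2 ^ n \<le> (\<Sum>z\<in>?L n. \<bar>f (c # z)\<bar>)" if "c \<in> V" "f (c # y) \<noteq> 0" for c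
  proof (rule Suc.IH[of "\<lambda>z. f (c # z)" y])
    fix xs ys
    assume "length xs + length ys + 1 = n" "set xs \<subseteq> V" "set ys \<subseteq> V"
    then show "(\<Sum>a\<in>V. f (c # xs @ a # ys)) = 0"
      using Suc.prems(1)[of "c # xs" ys] that(1) by simp
  qed (use x that in auto)
  have "2 ^ Suc n \<le> (\<Sum>z\<in>?L n. \<bar>f (a # z)\<bar>) + (\<Sum>z\<in>?L n. \<bar>f (b # z)\<bar>)"
    using slice[OF b(1,3)] slice[OF x(3)] Suc.prems(4) x(1) by simp
  also have "\<dots> = (\<Sum>w\<in>(#) a ` ?L n. \<bar>f w\<bar>) + (\<Sum>w\<in>(#) b ` ?L n. \<bar>f w\<bar>)"
    by (simp add: sum.reindex)
  also have "\<dots> = (\<Sum>w\<in>(#) a ` ?L n \<union> (#) b ` ?L n. \<bar>f w\<bar>)"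
    using fin b(2) by (intro sum.union_disjoint[symmetric]) auto
  also have "\<dots> \<le> (\<Sum>w\<in>?L (Suc n). \<bar>f w\<bar>)"
    using fin x(3) b(1) by (intro sum_mono2) auto
  finally show ?case .
qed

lemma sorted_list_of_set_remove_atLeastLessThan:
  assumes "p < k"
  shows "sorted_list_of_set ({0..<k} - {p}) = [0..<p] @ [Suc p..<k]"
proof -
  have "{0..<k} - {p} = set ([0..<p] @ [Suc p..<k])" using assms by auto
  moreover have "sorted ([0..<p] @ [Suc p..<k])" "distinct ([0..<p] @ [Suc p..<k])"
    by (auto simp: sorted_append)
  ultimately show ?thesis by (metis sorted_list_of_set.idem_if_sorted_distinct)
qed

text \<open>Omitting a single position turns containment into membership in an axis-parallel line:
  \<open>xs\<close> and \<open>ys\<close> are the entries before and after the omitted position, and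
  \<open>a\<close> is the free entry there.\<close>

lemma contains_remove_iff:
  assumes "length xs + length ys + 1 = k" "length x = k"
  shows "contains x ({0..<k} - {length xs}) (xs @ ys) \<longleftrightarrow> (\<exists>a. x = xs @ a # ys)"
proof -
  let ?p = "length xs"
  from assms have "?p < length x" by simp
  then obtain xs' a ys' where x: "x = xs' @ a # ys'" "length xs' = ?p"
    by (metis id_take_nth_drop length_take min.absorb4)
  then have len: "length ys' = length ys" using assms by simp
  have "contains x ({0..<k} - {?p}) (xs @ ys) \<longleftrightarrow>
    (\<forall>j < ?p + length ys. x ! (([0..<?p] @ [Suc ?p..<k]) ! j) = (xs @ ys) ! j)"
    using assms(1) by (auto simp: contains_def sorted_list_of_set_remove_atLeastLessThan)
  \<comment> \<open>The enumeration skips \<open>?p\<close>, so reading \<open>x\<close> along it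
    yields \<open>x\<close> with its entry \<open>a\<close> deleted.\<close>
  also have "\<dots> \<longleftrightarrow> (\<forall>j < ?p + length ys. (xs' @ ys') ! j = (xs @ ys) ! j)"
  proof (intro all_cong1 imp_cong refl)
    fix j assume "j < ?p + length ys"
    then show "x ! (([0..<?p] @ [Suc ?p..<k]) ! j) = (xs @ ys) ! j \<longleftrightarrow>
        (xs' @ ys') ! j = (xs @ ys) ! j"
      using x assms by (auto simp: nth_append)
  qed
  also have "\<dots> \<longleftrightarrow> xs' @ ys' = xs @ ys" using x len by (auto simp: list_eq_iff_nth_eq)
  also have "\<dots> \<longleftrightarrow> (\<exists>a. x = xs @ a # ys)" using x by auto
  finally show ?thesis .
qed

text \<open>The counted elements lie on one line, and the bound on \<open>M\<close> confines the
  free entry to \<open>{1..v}\<close>. This turns the trade condition into an equality of line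
  sums.\<close>

lemma size_filter_contains_remove:
  assumes "length xs + length ys + 1 = k" "set_mset M \<subseteq> tuples v k"
  shows "size {#x \<in># M. contains x ({0..<k} - {length xs}) (xs @ ys)#} =
    (\<Sum>a\<in>{1..v}. count M (xs @ a # ys))"
proof -
  let ?N = "{#x \<in># M. contains x ({0..<k} - {length xs}) (xs @ ys)#}"
  let ?line = "(\<lambda>a. xs @ a # ys) ` {1..v}"
  have iff: "contains x ({0..<k} - {length xs}) (xs @ ys) \<longleftrightarrow> (\<exists>a. x = xs @ a # ys)"
    if "length x = k" for x
    using contains_remove_iff[OF assms(1) that] .
  have "set_mset ?N \<subseteq> ?line"
  proof
    fix x assume "x \<in> set_mset ?N"
    then have "x \<in> tuples v k" "contains x ({0..<k} - {length xs}) (xs @ ys)"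
      using assms(2) by auto
    then show "x \<in> ?line" using iff by (auto simp: tuples_def)
  qed
  \<comment> \<open>Points of the line outside \<open>?N\<close> have multiplicity 0, so summing
    over the whole line changes nothing.\<close>
  then have "size ?N = (\<Sum>x\<in>?line. count ?N x)"
    unfolding size_multiset_overloaded_eq
    by (intro sum.mono_neutral_left) (auto simp del: set_mset_filter count_filter_mset simp: not_in_iff)
  also have "\<dots> = (\<Sum>a\<in>{1..v}. count ?N (xs @ a # ys))"
    by (subst sum.reindex) (auto simp: inj_on_def)
  also have "\<dots> = (\<Sum>a\<in>{1..v}. count M (xs @ a # ys))"
    using iff assms(1) by (intro sum.cong) auto
  finally show ?thesis .
qed

theorem theorem2:
  fixes t s v :: nat
  assumes "1 \<le> t" and "0 < s" and "s < 2 ^ t" and "1 \<le> v"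
  shows "\<not> (\<exists>T. latin_trade t v (t + 1) s T)"
proof
  assume "\<exists>T. latin_trade t v (t + 1) s T"
  then obtain A B where "latin_trade t v (t + 1) s (A, B)" by auto
  then have sub: "set_mset A \<subseteq> tuples v (t + 1)" "set_mset B \<subseteq> tuples v (t + 1)"
    and size: "size A = s" "size B = s" and disj: "set_mset A \<inter> set_mset B = {}"
    and eq: "\<And>I u. I \<subseteq> {0..<t + 1} \<Longrightarrow> card I = t \<Longrightarrow> u \<in> tuples v t \<Longrightarrow>
        size {#x \<in># A. contains x I u#} = size {#x \<in># B. contains x I u#}"
    unfolding latin_trade_def by auto
  define f where "f x = int (count A x) - int (count B x)" for x
  have fin: "finite (tuples v (t + 1))"
    using finite_lists_length_eq[of "{1..v}" "t + 1"] by (simp add: tuples_def conj_commute)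
  have total: "(\<Sum>x\<in>tuples v (t + 1). count M x) = size M" if "set_mset M \<subseteq> tuples v (t + 1)" for M
    unfolding size_multiset_overloaded_eq
    using that fin by (intro sum.mono_neutral_right) (auto simp: count_eq_zero_iff)
  from size(1) assms(2) obtain x where x: "x \<in># A" by (metis multiset_nonemptyE not_gr0 size_empty)
  have "2 ^ (t + 1) \<le> (\<Sum>x | length x = t + 1 \<and> set x \<subseteq> {1..v}. \<bar>f x\<bar>)"
  proof (rule sum_abs_ge_power2_if_line_sums_zero)
    fix xs ys :: "nat list"
    assume l: "length xs + length ys + 1 = t + 1" "set xs \<subseteq> {1..v}" "set ys \<subseteq> {1..v}"
    \<comment> \<open>As \<open>k = t + 1\<close>, removing the position \<open>length xs\<close>
      leaves exactly \<open>t\<close> positions, so the trade condition applies.\<close>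
    then have "(\<Sum>a\<in>{1..v}. count A (xs @ a # ys)) = (\<Sum>a\<in>{1..v}. count B (xs @ a # ys))"
      using eq[of "{0..<t + 1} - {length xs}" "xs @ ys"]
      unfolding size_filter_contains_remove[OF l(1) sub(1)] size_filter_contains_remove[OF l(1) sub(2)]
      by (auto simp: tuples_def)
    then show "(\<Sum>a\<in>{1..v}. f (xs @ a # ys)) = 0"
      by (simp add: f_def sum_subtractf flip: of_nat_sum)
  next
    show "length x = t + 1" "set x \<subseteq> {1..v}" using x sub(1) by (auto simp: tuples_def)
    \<comment> \<open>Disjointness prevents cancellation at \<open>x\<close>, which exists because
      \<open>s\<close> is positive.\<close>
    have "count B x = 0" using x disj by (auto simp: count_eq_zero_iff)
    then show "f x \<noteq> 0" using x by (simp add: f_def)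
  qed simp
  \<comment> \<open>The triangle inequality at each point suffices here; cancelling a factor 2 then
    leaves \<open>2 ^ t\<close> \<le> \<open>s\<close>.\<close>
  also have "\<dots> \<le> (\<Sum>x\<in>tuples v (t + 1). int (count A x) + int (count B x))"
    unfolding tuples_def by (intro sum_mono) (simp add: f_def)
  also have "\<dots> = int (2 * s)"
    using total[OF sub(1)] total[OF sub(2)] size by (simp add: sum.distrib flip: of_nat_sum)
  finally have "(2::int) ^ t \<le> int s" by simp
  then show False using assms(3) by (metis linorder_not_less of_nat_le_iff of_nat_numeral of_nat_power)
qed

end
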